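(* There exist a $C^*$-algebra $\mathfrak{A}$, Hilbert $\mathfrak{A}$-modules $E,H,K$, and adjointable operators $A\in\mathcal{L}(H,K)$ and $C\in\mathcal{L}(E,K)$ such that the operator equation $$AX=C,\quad X\in\mathcal{L}(E,H),$$ has a unique solution, whereas this unique solution is not the reduced solution of the equation.
   Context: For Hilbert $\mathfrak{A}$-modules $H,K$, $\mathcal{L}(H,K)$ denotes the set of adjointable operators from $H$ to $K$. An operator $D\in\mathcal{L}(E,H)$ is the reduced solution of $AX=C$ if $AD=C$ and $\mathcal{R}(D)\subseteq\overline{\mathcal{R}(A^* )}$, where $\mathcal{R}(\cdot)$ denotes range and the bar denotes norm closure. *)

theory Defs
  imports "HOL-Analysis.Analysis" "HOL-Algebra.Module"
begin

definition complex_field :: "complex ring" where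
  "complex_field = \<lparr>carrier = UNIV, mult = (*), one = 1, zero = 0, add = (+)\<rparr>"

text \<open>The distance \<open>\<nu> (x - y)\<close> on a carrier with norm \<open>\<nu>\<close>. It is set to 0 off the carrier because
  the locale \<open>Metric_space\<close> demands nonnegativity and symmetry on the whole type.\<close>

definition norm_dist :: "('a, 'b) ring_scheme \<Rightarrow> ('a \<Rightarrow> real) \<Rightarrow> 'a \<Rightarrow> 'a \<Rightarrow> real" where
  "norm_dist M \<nu> x y =
     (if x \<in> carrier M \<and> y \<in> carrier M then \<nu> (x \<ominus>\<^bsub>M\<^esub> y) else 0)"

text \<open>\<open>C\<^sup>*\<close>-algebras are not required to be unital: the field \<open>one\<close> inherited from the ring record
  is not constrained.\<close>

record 'a cstar_algebra = "(complex, 'a) module" +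
  star :: "'a \<Rightarrow> 'a"
  cnorm :: "'a \<Rightarrow> real"

locale cstar_algebra = Module.module complex_field A for A (structure) +
  assumes mult_closed: "\<lbrakk>x \<in> carrier A; y \<in> carrier A\<rbrakk> \<Longrightarrow> x \<otimes> y \<in> carrier A"
    and mult_assoc: "\<lbrakk>x \<in> carrier A; y \<in> carrier A; z \<in> carrier A\<rbrakk> \<Longrightarrow>
        (x \<otimes> y) \<otimes> z = x \<otimes> (y \<otimes> z)"
    and distrib_left: "\<lbrakk>x \<in> carrier A; y \<in> carrier A; z \<in> carrier A\<rbrakk> \<Longrightarrow>
        x \<otimes> (y \<oplus> z) = x \<otimes> y \<oplus> x \<otimes> z"
    and distrib_right: "\<lbrakk>x \<in> carrier A; y \<in> carrier A; z \<in> carrier A\<rbrakk> \<Longrightarrow>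
        (x \<oplus> y) \<otimes> z = x \<otimes> z \<oplus> y \<otimes> z"
    and smult_mult_left: "\<lbrakk>x \<in> carrier A; y \<in> carrier A\<rbrakk> \<Longrightarrow> (c \<odot> x) \<otimes> y = c \<odot> (x \<otimes> y)"
    and smult_mult_right: "\<lbrakk>x \<in> carrier A; y \<in> carrier A\<rbrakk> \<Longrightarrow> x \<otimes> (c \<odot> y) = c \<odot> (x \<otimes> y)"
    and star_closed: "x \<in> carrier A \<Longrightarrow> star A x \<in> carrier A"
    and star_star: "x \<in> carrier A \<Longrightarrow> star A (star A x) = x"
    and star_add: "\<lbrakk>x \<in> carrier A; y \<in> carrier A\<rbrakk> \<Longrightarrow> star A (x \<oplus> y) = star A x \<oplus> star A y"
    and star_smult: "x \<in> carrier A \<Longrightarrow> star A (c \<odot> x) = cnj c \<odot> star A x"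
    and star_mult: "\<lbrakk>x \<in> carrier A; y \<in> carrier A\<rbrakk> \<Longrightarrow> star A (x \<otimes> y) = star A y \<otimes> star A x"
    and cnorm_nonneg: "x \<in> carrier A \<Longrightarrow> 0 \<le> cnorm A x"
    and cnorm_eq_0: "x \<in> carrier A \<Longrightarrow> cnorm A x = 0 \<longleftrightarrow> x = \<zero>"
    and cnorm_triangle: "\<lbrakk>x \<in> carrier A; y \<in> carrier A\<rbrakk> \<Longrightarrow>
        cnorm A (x \<oplus> y) \<le> cnorm A x + cnorm A y"
    and cnorm_smult: "x \<in> carrier A \<Longrightarrow> cnorm A (c \<odot> x) = cmod c * cnorm A x"
    and cnorm_mult: "\<lbrakk>x \<in> carrier A; y \<in> carrier A\<rbrakk> \<Longrightarrow>
        cnorm A (x \<otimes> y) \<le> cnorm A x * cnorm A y"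
    and complete: "Metric_space.mcomplete (carrier A) (norm_dist A (cnorm A))"
    and cstar_identity: "x \<in> carrier A \<Longrightarrow> cnorm A (star A x \<otimes> x) = (cnorm A x)\<^sup>2"

definition positive_elements :: "('a, 'z) cstar_algebra_scheme \<Rightarrow> 'a set" where
  "positive_elements A = {star A b \<otimes>\<^bsub>A\<^esub> b | b. b \<in> carrier A}"

text \<open>Right Hilbert modules, with an inner product that is linear in the second variable.
  As usual for the record \<open>module\<close>, the inherited fields \<open>mult\<close> and \<open>one\<close> play no role.\<close>

record ('a, 'm) hilbert_module = "(complex, 'm) module" +
  act :: "'m \<Rightarrow> 'a \<Rightarrow> 'm"
  iprod :: "'m \<Rightarrow> 'm \<Rightarrow> 'a"

definition module_norm ::
  "('a, 'z) cstar_algebra_scheme \<Rightarrow> ('a, 'm, 'w) hilbert_module_scheme \<Rightarrow> 'm \<Rightarrow> real" where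
  "module_norm A H x = sqrt (cnorm A (iprod H x x))"

locale hilbert_module = A: cstar_algebra A + Module.module complex_field H
  for A and H (structure) +
  assumes act_closed: "\<lbrakk>x \<in> carrier H; a \<in> carrier A\<rbrakk> \<Longrightarrow> act H x a \<in> carrier H"
    and act_add_left: "\<lbrakk>x \<in> carrier H; y \<in> carrier H; a \<in> carrier A\<rbrakk> \<Longrightarrow>
        act H (x \<oplus> y) a = act H x a \<oplus> act H y a"
    and act_add_right: "\<lbrakk>x \<in> carrier H; a \<in> carrier A; b \<in> carrier A\<rbrakk> \<Longrightarrow>
        act H x (a \<oplus>\<^bsub>A\<^esub> b) = act H x a \<oplus> act H x b"
    and act_mult: "\<lbrakk>x \<in> carrier H; a \<in> carrier A; b \<in> carrier A\<rbrakk> \<Longrightarrow>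
        act H x (a \<otimes>\<^bsub>A\<^esub> b) = act H (act H x a) b"
    and act_smult_left: "\<lbrakk>x \<in> carrier H; a \<in> carrier A\<rbrakk> \<Longrightarrow>
        act H (c \<odot> x) a = c \<odot> act H x a"
    and act_smult_right: "\<lbrakk>x \<in> carrier H; a \<in> carrier A\<rbrakk> \<Longrightarrow>
        act H x (c \<odot>\<^bsub>A\<^esub> a) = c \<odot> act H x a"
    and iprod_closed: "\<lbrakk>x \<in> carrier H; y \<in> carrier H\<rbrakk> \<Longrightarrow> iprod H x y \<in> carrier A"
    and iprod_add: "\<lbrakk>x \<in> carrier H; y \<in> carrier H; z \<in> carrier H\<rbrakk> \<Longrightarrow>
        iprod H x (y \<oplus> z) = iprod H x y \<oplus>\<^bsub>A\<^esub> iprod H x z"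
    and iprod_smult: "\<lbrakk>x \<in> carrier H; y \<in> carrier H\<rbrakk> \<Longrightarrow>
        iprod H x (c \<odot> y) = c \<odot>\<^bsub>A\<^esub> iprod H x y"
    and iprod_act: "\<lbrakk>x \<in> carrier H; y \<in> carrier H; a \<in> carrier A\<rbrakk> \<Longrightarrow>
        iprod H x (act H y a) = iprod H x y \<otimes>\<^bsub>A\<^esub> a"
    and iprod_star: "\<lbrakk>x \<in> carrier H; y \<in> carrier H\<rbrakk> \<Longrightarrow>
        iprod H y x = star A (iprod H x y)"
    and iprod_positive: "x \<in> carrier H \<Longrightarrow> iprod H x x \<in> positive_elements A"
    and iprod_definite: "\<lbrakk>x \<in> carrier H; iprod H x x = \<zero>\<^bsub>A\<^esub>\<rbrakk> \<Longrightarrow> x = \<zero>"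
    and complete: "Metric_space.mcomplete (carrier H) (norm_dist H (module_norm A H))"

definition norm_closure ::
  "('a, 'z) cstar_algebra_scheme \<Rightarrow> ('a, 'm, 'w) hilbert_module_scheme \<Rightarrow> 'm set \<Rightarrow> 'm set" where
  "norm_closure A H S =
     Metric_space.mtopology (carrier H) (norm_dist H (module_norm A H)) closure_of S"

text \<open>Operators are extensional functions (\<open>undefined\<close> off the carrier of their domain), so that
  equality of operators is equality in HOL. Adjointable operators are automatically
  linear and bounded, so this is not part of the definition.\<close>

definition is_adjoint ::
  "('a, 'm, 'v) hilbert_module_scheme \<Rightarrow> ('a, 'n, 'w) hilbert_module_scheme \<Rightarrow>
    ('m \<Rightarrow> 'n) \<Rightarrow> ('n \<Rightarrow> 'm) \<Rightarrow> bool" where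
  "is_adjoint H K T S \<longleftrightarrow>
     S \<in> carrier K \<rightarrow>\<^sub>E carrier H \<and>
     (\<forall>x\<in>carrier H. \<forall>y\<in>carrier K. iprod K (T x) y = iprod H x (S y))"

definition adjointable ::
  "('a, 'm, 'v) hilbert_module_scheme \<Rightarrow> ('a, 'n, 'w) hilbert_module_scheme \<Rightarrow> ('m \<Rightarrow> 'n) set" where
  "adjointable H K = {T \<in> carrier H \<rightarrow>\<^sub>E carrier K. \<exists>S. is_adjoint H K T S}"

definition adjoint_op ::
  "('a, 'm, 'v) hilbert_module_scheme \<Rightarrow> ('a, 'n, 'w) hilbert_module_scheme \<Rightarrow>
    ('m \<Rightarrow> 'n) \<Rightarrow> 'n \<Rightarrow> 'm" where
  "adjoint_op H K T = (THE S. is_adjoint H K T S)"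

definition solutions ::
  "('a, 'l, 'u) hilbert_module_scheme \<Rightarrow> ('a, 'm, 'v) hilbert_module_scheme \<Rightarrow>
    ('m \<Rightarrow> 'n) \<Rightarrow> ('l \<Rightarrow> 'n) \<Rightarrow> ('l \<Rightarrow> 'm) set" where
  "solutions E H T C = {X \<in> adjointable E H. compose (carrier E) T X = C}"

definition reduced_solution ::
  "('a, 'z) cstar_algebra_scheme \<Rightarrow> ('a, 'l, 'u) hilbert_module_scheme \<Rightarrow>
    ('a, 'm, 'v) hilbert_module_scheme \<Rightarrow> ('a, 'n, 'w) hilbert_module_scheme \<Rightarrow>
    ('m \<Rightarrow> 'n) \<Rightarrow> ('l \<Rightarrow> 'n) \<Rightarrow> ('l \<Rightarrow> 'm) \<Rightarrow> bool" where
  "reduced_solution A E H K T C D \<longleftrightarrow>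
     D \<in> solutions E H T C \<and>
     D ` carrier E \<subseteq> norm_closure A H (adjoint_op H K T ` carrier K)"

end

theory Submission
  imports Defs
begin

text \<open>Over \<open>\<AA> = C\<^sub>b(\<real>)\<close>, seen as a module over itself, let \<open>A = C\<close> be multiplication by the function
  \<open>b(t) = min 1 \<bar>t\<bar>\<close>. As \<open>b\<close> vanishes only at \<open>0\<close>, multiplication by \<open>b\<close> is injective on continuous
  functions, so the identity is the only solution of \<open>A X = A\<close>. On the other hand all functions in
  the closure of the range of \<open>A\<^sup>* = A\<close> vanish at \<open>0\<close>, so this closure does not contain the constant
  \<open>1\<close>.\<close>

section \<open>A \<open>C\<^sup>*\<close>-algebra as a Hilbert module over itself\<close>

definition self_module :: "('a, 'z) cstar_algebra_scheme \<Rightarrow> ('a, 'a) hilbert_module" where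
  "self_module A = \<lparr>carrier = carrier A, mult = mult A, one = one A, zero = zero A, add = add A,
     smult = smult A, act = mult A, iprod = (\<lambda>x y. star A x \<otimes>\<^bsub>A\<^esub> y)\<rparr>"

lemma self_module_simps [simp]:
  "carrier (self_module A) = carrier A"
  "zero (self_module A) = zero A"
  "add (self_module A) = add A"
  "smult (self_module A) = smult A"
  "act (self_module A) = mult A"
  "iprod (self_module A) x y = star A x \<otimes>\<^bsub>A\<^esub> y"
  "a_minus (self_module A) = a_minus A"
  by (auto simp: self_module_def a_inv_def m_inv_def a_minus_def fun_eq_iff)

context cstar_algebra
begin

text \<open>The C*-identity turns the norm of \<open>star A x \<otimes> x\<close> into a square,
  which the root undoes. Completeness of the module thereby reduces to completeness of the
  algebra.\<close>

lemma module_norm_self_module: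
  assumes "x \<in> carrier A"
  shows "module_norm A (self_module A) x = cnorm A x"
  using assms by (simp add: module_norm_def cstar_identity cnorm_nonneg)

lemma norm_dist_self_module:
  "norm_dist (self_module A) (module_norm A (self_module A)) = norm_dist A (cnorm A)"
  by (auto simp: norm_dist_def fun_eq_iff module_norm_self_module)

lemma module_self_module: "Module.module complex_field (self_module A)"
proof -
  have "abelian_group (self_module A)"
  proof (rule abelian_groupI)
    fix x assume "x \<in> carrier (self_module A)"
    then show "\<exists>y\<in>carrier (self_module A). y \<oplus>\<^bsub>self_module A\<^esub> x = \<zero>\<^bsub>self_module A\<^esub>"
      by (intro bexI[of _ "\<ominus> x"]) (simp_all add: M.l_neg)
  qed (auto intro: M.a_assoc M.a_comm)
  then show ?thesis
    using module_axioms
    by (simp add: Module.module_def module_axioms_def)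
qed

lemma hilbert_module_self_module: "hilbert_module A (self_module A)"
proof (intro hilbert_module.intro hilbert_module_axioms.intro)
  show "cstar_algebra A" ..
  show "Module.module complex_field (self_module A)"
    by (rule module_self_module)
  fix x assume x: "x \<in> carrier (self_module A)"
  show "iprod (self_module A) x x \<in> positive_elements A"
    using x by (auto simp: positive_elements_def)
  \<comment> \<open>By the C*-identity the square of \<open>cnorm A x\<close> is the norm of zero,
    so \<open>x\<close> is zero.\<close>
  assume "iprod (self_module A) x x = \<zero>\<^bsub>A\<^esub>"
  then show "x = \<zero>\<^bsub>self_module A\<^esub>"
    using x cstar_identity[of x] cnorm_eq_0[of x] cnorm_eq_0[of "\<zero>\<^bsub>A\<^esub>"] by simp
next
  show "Metric_space.mcomplete (carrier (self_module A))
      (norm_dist (self_module A) (module_norm A (self_module A)))"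
    using complete by (simp add: norm_dist_self_module)
qed (simp_all add: mult_closed mult_assoc distrib_left distrib_right smult_mult_left
      smult_mult_right star_closed star_mult star_star)

end

text \<open>Two candidate values at \<open>y\<close> have the same inner product with every element
  of \<open>H\<close>, so their difference is orthogonal to itself and vanishes by definiteness.
  This makes the description in \<open>adjoint_op\<close> meaningful.\<close>

lemma (in hilbert_module) is_adjoint_unique:
  assumes S: "is_adjoint H K T S" and S': "is_adjoint H K T S'"
  shows "S = S'"
proof (rule PiE_ext)
  show "S \<in> carrier K \<rightarrow>\<^sub>E carrier H" "S' \<in> carrier K \<rightarrow>\<^sub>E carrier H"
    using S S' by (simp_all add: is_adjoint_def)
  fix y assume y: "y \<in> carrier K"
  let ?s = "S y" and ?s' = "S' y"
  have s: "?s \<in> carrier H" "?s' \<in> carrier H"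
    using S S' y by (auto simp: is_adjoint_def)
  \<comment> \<open>The difference is used as a summand of \<open>?s\<close>, because
    \<open>iprod_add\<close> speaks of sums.\<close>
  define d where "d = ?s \<ominus> ?s'"
  have d: "d \<in> carrier H" and sum: "?s = d \<oplus> ?s'"
    using s by (simp_all add: d_def M.minus_eq M.a_assoc M.l_neg)
  have "iprod H d d \<oplus>\<^bsub>A\<^esub> iprod H d ?s' = iprod H d ?s"
    using d s sum iprod_add by simp
  \<comment> \<open>Both sides equal \<open>iprod K (T d) y\<close>.\<close>
  also have "\<dots> = iprod H d ?s'"
    using S S' y d by (metis is_adjoint_def)
  finally have "iprod H d d = \<zero>\<^bsub>A\<^esub>"
    using iprod_closed d s by simp
  then have "d = \<zero>"
    using iprod_definite d by blast
  then show "?s = ?s'"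
    using sum s by simp
qed

lemma (in hilbert_module) adjoint_op_eq:
  assumes "is_adjoint H K T S"
  shows "adjoint_op H K T = S"
  unfolding adjoint_op_def using assms is_adjoint_unique by blast

section \<open>The algebra of bounded continuous functions\<close>

text \<open>Elements are plain functions, so that products and conjugates are pointwise expressions.
  The norm is the supremum norm, taken from the type of bounded continuous functions through
  \<open>Bcontfun\<close>, which is meaningful on the set \<open>bcontfun\<close>.\<close>

definition bcont_algebra :: "('a::topological_space \<Rightarrow> complex) cstar_algebra" where
  "bcont_algebra = \<lparr>carrier = bcontfun, mult = (\<lambda>f g x. f x * g x), one = (\<lambda>x. 1),
     zero = (\<lambda>x. 0), add = (\<lambda>f g x. f x + g x), smult = (\<lambda>c f x. c * f x),
     star = (\<lambda>f x. cnj (f x)), cnorm = (\<lambda>f. norm (Bcontfun f))\<rparr>"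

lemma bcont_algebra_simps [simp]:
  "carrier bcont_algebra = bcontfun"
  "f \<otimes>\<^bsub>bcont_algebra\<^esub> g = (\<lambda>x. f x * g x)"
  "\<zero>\<^bsub>bcont_algebra\<^esub> = (\<lambda>x. 0)"
  "f \<oplus>\<^bsub>bcont_algebra\<^esub> g = (\<lambda>x. f x + g x)"
  "c \<odot>\<^bsub>bcont_algebra\<^esub> f = (\<lambda>x. c * f x)"
  "star bcont_algebra f = (\<lambda>x. cnj (f x))"
  "cnorm bcont_algebra f = norm (Bcontfun f)"
  by (simp_all add: bcont_algebra_def)

section \<open>Pointwise operations and the supremum norm\<close>

lemma mult_bcontfun:
  fixes f g :: "'a::topological_space \<Rightarrow> 'b::real_normed_algebra"
  assumes "f \<in> bcontfun" "g \<in> bcontfun"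
  shows "(\<lambda>x. f x * g x) \<in> bcontfun"
proof -
  obtain F G where "\<And>x. norm (f x) \<le> F" "\<And>x. norm (g x) \<le> G"
    using assms by (auto simp: bcontfun_def bounded_iff)
  then have "norm (f x * g x) \<le> F * G" for x
    by (meson mult_mono norm_ge_zero norm_mult_ineq order_trans)
  moreover have "continuous_on UNIV (\<lambda>x. f x * g x)"
    using assms by (auto simp: bcontfun_def intro!: continuous_intros)
  ultimately show ?thesis
    using bcontfun_normI by blast
qed

lemma cnj_bcontfun: "f \<in> bcontfun \<Longrightarrow> (\<lambda>x. cnj (f x)) \<in> bcontfun"
  by (auto simp: bcontfun_def bounded_iff intro!: continuous_intros)

text \<open>Together with \<open>norm_Bcontfun_le\<close> this describes the norm as the least
  pointwise bound; the estimates for products, multiples and \<open>cnj (f x) * f x\<close> follow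
  from these two facts.\<close>

lemma norm_le_norm_Bcontfun:
  fixes f :: "'a::topological_space \<Rightarrow> 'b::real_normed_vector"
  shows "f \<in> bcontfun \<Longrightarrow> norm (f x) \<le> norm (Bcontfun f)"
  using norm_bounded[of "Bcontfun f" x] by (simp add: Bcontfun_inverse)

lemma norm_Bcontfun_le:
  fixes f :: "'a::topological_space \<Rightarrow> 'b::real_normed_vector"
  shows "f \<in> bcontfun \<Longrightarrow> (\<And>x. norm (f x) \<le> b) \<Longrightarrow> norm (Bcontfun f) \<le> b"
  using norm_bound[of "Bcontfun f" b] by (simp add: Bcontfun_inverse)

lemma norm_Bcontfun_mult_le:
  fixes f g :: "'a::topological_space \<Rightarrow> 'b::real_normed_algebra"
  assumes "f \<in> bcontfun" "g \<in> bcontfun"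
  shows "norm (Bcontfun (\<lambda>x. f x * g x)) \<le> norm (Bcontfun f) * norm (Bcontfun g)"
proof (rule norm_Bcontfun_le)
  show "norm (f x * g x) \<le> norm (Bcontfun f) * norm (Bcontfun g)" for x
    using assms
    by (intro order_trans[OF norm_mult_ineq] mult_mono norm_le_norm_Bcontfun) auto
qed (use assms mult_bcontfun in auto)

lemma norm_Bcontfun_scale:
  fixes f :: "'a::topological_space \<Rightarrow> 'b::real_normed_field"
  assumes f: "f \<in> bcontfun"
  shows "norm (Bcontfun (\<lambda>x. c * f x)) = norm c * norm (Bcontfun f)"
proof (cases "c = 0")
  case True
  then show ?thesis
    using norm_Bcontfun_le[OF const_bcontfun, of 0 0] by simp
next
  case False
  have cf: "(\<lambda>x. c * f x) \<in> bcontfun"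
    by (rule mult_bcontfun[OF const_bcontfun f])
  \<comment> \<open>Dividing by the nonzero \<open>c\<close> yields the harder inequality.\<close>
  have "norm (f x) \<le> norm (Bcontfun (\<lambda>x. c * f x)) / norm c" for x
    using norm_le_norm_Bcontfun[OF cf, of x] False by (simp add: norm_mult field_simps)
  then have "norm (Bcontfun f) \<le> norm (Bcontfun (\<lambda>x. c * f x)) / norm c"
    by (rule norm_Bcontfun_le[OF f])
  moreover have "norm (Bcontfun (\<lambda>x. c * f x)) \<le> norm c * norm (Bcontfun f)"
    using norm_le_norm_Bcontfun[OF f]
    by (intro norm_Bcontfun_le[OF cf]) (simp add: norm_mult mult_left_mono)
  ultimately show ?thesis
    using False by (simp add: field_simps)
qed

text \<open>The C*-identity holds at each point. Squaring and taking roots are monotone on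
  nonnegative reals, so upper bounds carry over in both directions.\<close>

lemma norm_Bcontfun_cnj_mult:
  assumes f: "f \<in> bcontfun"
  shows "norm (Bcontfun (\<lambda>x. cnj (f x) * f x)) = (norm (Bcontfun f))\<^sup>2"
proof (rule antisym)
  have ff: "(\<lambda>x. cnj (f x) * f x) \<in> bcontfun"
    using mult_bcontfun cnj_bcontfun f by blast
  have sq: "norm (cnj (f x) * f x) = (norm (f x))\<^sup>2" for x
    by (simp add: norm_mult power2_eq_square)
  show "norm (Bcontfun (\<lambda>x. cnj (f x) * f x)) \<le> (norm (Bcontfun f))\<^sup>2"
    by (rule norm_Bcontfun_le[OF ff])
      (simp add: sq norm_le_norm_Bcontfun[OF f] power_mono)
  have "norm (f x) \<le> sqrt (norm (Bcontfun (\<lambda>x. cnj (f x) * f x)))" for x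
    using norm_le_norm_Bcontfun[OF ff, of x] by (simp add: sq real_le_rsqrt)
  then have "norm (Bcontfun f) \<le> sqrt (norm (Bcontfun (\<lambda>x. cnj (f x) * f x)))"
    by (rule norm_Bcontfun_le[OF f])
  then show "(norm (Bcontfun f))\<^sup>2 \<le> norm (Bcontfun (\<lambda>x. cnj (f x) * f x))"
    using real_sqrt_le_iff real_sqrt_abs by (metis abs_norm_cancel)
qed

lemma Bcontfun_add:
  fixes f g :: "'a::topological_space \<Rightarrow> 'b::real_normed_vector"
  shows "f \<in> bcontfun \<Longrightarrow> g \<in> bcontfun \<Longrightarrow> Bcontfun (\<lambda>x. f x + g x) = Bcontfun f + Bcontfun g"
  by (rule bcontfun_eqI) (simp add: Bcontfun_inverse plus_cont)

lemma Bcontfun_diff: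
  fixes f g :: "'a::topological_space \<Rightarrow> 'b::real_normed_vector"
  shows "f \<in> bcontfun \<Longrightarrow> g \<in> bcontfun \<Longrightarrow> Bcontfun (\<lambda>x. f x - g x) = Bcontfun f - Bcontfun g"
  by (rule bcontfun_eqI) (simp add: Bcontfun_inverse minus_cont)

lemma Bcontfun_eq_0_iff:
  fixes f :: "'a::topological_space \<Rightarrow> 'b::real_normed_vector"
  shows "f \<in> bcontfun \<Longrightarrow> Bcontfun f = 0 \<longleftrightarrow> f = (\<lambda>x. 0)"
  using Bcontfun_inject[OF _ const_bcontfun, of f 0]
  by (simp add: zero_bcontfun_def const_bcontfun_def)

section \<open>Algebraic structure, metric and completeness\<close>

lemma cring_complex_field: "cring complex_field"
proof (rule cringI)
  show "abelian_group complex_field"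
    by (rule abelian_groupI)
      (auto simp: complex_field_def algebra_simps intro: exI[of _ "- x" for x])
  show "comm_monoid complex_field"
    by (rule comm_monoidI) (auto simp: complex_field_def)
qed (auto simp: complex_field_def algebra_simps)

lemma abelian_group_bcont_algebra: "abelian_group bcont_algebra"
proof (rule abelian_groupI)
  fix f :: "'a \<Rightarrow> complex"
  assume f: "f \<in> carrier bcont_algebra"
  then show "\<exists>g\<in>carrier bcont_algebra. g \<oplus>\<^bsub>bcont_algebra\<^esub> f = \<zero>\<^bsub>bcont_algebra\<^esub>"
    using uminus_cont[of f] by (intro bexI[of _ "\<lambda>x. - f x"]) auto
qed (auto simp: plus_cont const_bcontfun algebra_simps)

text \<open>Additive inverses in an abelian group are unique, so it suffices to exhibit the
  pointwise negative as one.\<close>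

lemma minus_bcont_algebra:
  assumes f: "f \<in> bcontfun" and g: "g \<in> bcontfun"
  shows "f \<ominus>\<^bsub>bcont_algebra\<^esub> g = (\<lambda>x. f x - g x)"
proof -
  interpret abelian_group bcont_algebra
    by (rule abelian_group_bcont_algebra)
  have "\<ominus>\<^bsub>bcont_algebra\<^esub> g = (\<lambda>x. - g x)"
    using g by (intro minus_equality) (auto simp: uminus_cont)
  then show ?thesis
    by (simp add: a_minus_def)
qed

text \<open>Serves to transport the metric axioms and completeness from the type of bounded
  continuous functions, \<open>Bcontfun\<close> being an isometry on the carrier.\<close>

lemma norm_dist_bcont_algebra:
  assumes "f \<in> bcontfun" "g \<in> bcontfun"
  shows "norm_dist bcont_algebra (cnorm bcont_algebra) f g = dist (Bcontfun f) (Bcontfun g)"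
  using assms by (simp add: norm_dist_def minus_bcont_algebra Bcontfun_diff dist_norm)

lemma Metric_space_bcont_algebra:
  "Metric_space bcontfun (norm_dist bcont_algebra (cnorm bcont_algebra))"
proof
  fix f g :: "'a \<Rightarrow> complex"
  let ?d = "norm_dist bcont_algebra (cnorm bcont_algebra)"
  have off: "?d f g = 0" if "f \<notin> bcontfun \<or> g \<notin> bcontfun" for f g :: "'a \<Rightarrow> complex"
    using that by (auto simp: norm_dist_def)
  show "0 \<le> ?d f g"
    by (cases "f \<in> bcontfun \<and> g \<in> bcontfun") (auto simp: norm_dist_bcont_algebra off)
  show "?d f g = ?d g f"
    by (cases "f \<in> bcontfun \<and> g \<in> bcontfun")
      (auto simp: norm_dist_bcont_algebra off dist_commute)
  assume fg: "f \<in> bcontfun" "g \<in> bcontfun"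
  then show "?d f g = 0 \<longleftrightarrow> f = g"
    by (simp add: norm_dist_bcont_algebra Bcontfun_inject)
  fix h :: "'a \<Rightarrow> complex"
  assume "h \<in> bcontfun"
  with fg show "?d f h \<le> ?d f g + ?d g h"
    by (simp add: norm_dist_bcont_algebra dist_triangle)
qed

lemma mcomplete_bcont_algebra:
  "Metric_space.mcomplete bcontfun
     (norm_dist bcont_algebra (cnorm (bcont_algebra :: ('a::metric_space \<Rightarrow> complex) cstar_algebra)))"
proof -
  let ?d = "norm_dist bcont_algebra
    (cnorm (bcont_algebra :: ('a \<Rightarrow> complex) cstar_algebra))"
  interpret Metric_space bcontfun ?d
    by (rule Metric_space_bcont_algebra)
  show ?thesis
    unfolding mcomplete_def
  proof (intro allI impI)
    fix \<sigma> :: "nat \<Rightarrow> 'a \<Rightarrow> complex"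
    assume \<sigma>: "MCauchy \<sigma>"
    have mem: "\<sigma> n \<in> bcontfun" for n
      using \<sigma> by (auto simp: MCauchy_def)
    have "Cauchy (\<lambda>n. Bcontfun (\<sigma> n))"
      using \<sigma> by (simp add: MCauchy_def Cauchy_def norm_dist_bcont_algebra mem)
    \<comment> \<open>The limit exists in the complete type of bounded continuous functions;
      \<open>apply_bcontfun\<close> brings it back to the carrier.\<close>
    then obtain F where F: "(\<lambda>n. Bcontfun (\<sigma> n)) \<longlonglongrightarrow> F"
      by (auto dest!: Cauchy_convergent simp: convergent_def)
    have "?d (\<sigma> n) (apply_bcontfun F) = dist (Bcontfun (\<sigma> n)) F" for n
      using norm_dist_bcont_algebra[OF mem apply_bcontfun] by (simp only: apply_bcontfun_inverse)
    then have "limitin mtopology \<sigma> (apply_bcontfun F) sequentially"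
      using F mem apply_bcontfun[of F]
      by (simp only: limit_metric_sequentially lim_sequentially simp_thms)
    then show "\<exists>f. limitin mtopology \<sigma> f sequentially"
      by blast
  qed
qed

lemma cstar_algebra_bcont_algebra:
  "cstar_algebra (bcont_algebra :: ('a::metric_space \<Rightarrow> complex) cstar_algebra)"
proof (intro cstar_algebra.intro cstar_algebra_axioms.intro)
  show "Module.module complex_field bcont_algebra"
    by (rule moduleI[OF cring_complex_field abelian_group_bcont_algebra])
      (auto simp: complex_field_def mult_bcontfun const_bcontfun algebra_simps)
  show "Metric_space.mcomplete (carrier bcont_algebra)
      (norm_dist bcont_algebra (cnorm (bcont_algebra :: ('a \<Rightarrow> complex) cstar_algebra)))"
    using mcomplete_bcont_algebra by simp
qed (auto simp: mult_bcontfun cnj_bcontfun Bcontfun_eq_0_iff Bcontfun_add norm_triangle_ineq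
      norm_Bcontfun_scale norm_Bcontfun_mult_le norm_Bcontfun_cnj_mult distrib_left distrib_right)

section \<open>Multiplication operators\<close>

text \<open>The restriction makes the operator extensional, as \<open>adjointable\<close> demands;
  \<open>mult_op (\<lambda>x. 1)\<close> is then the identity operator.\<close>

definition mult_op :: "('a::topological_space \<Rightarrow> complex) \<Rightarrow> ('a \<Rightarrow> complex) \<Rightarrow> 'a \<Rightarrow> complex" where
  "mult_op b = restrict (\<lambda>f x. b x * f x) bcontfun"

abbreviation bcont_module ::
  "('a::topological_space \<Rightarrow> complex, 'a \<Rightarrow> complex) hilbert_module" where
  "bcont_module \<equiv> self_module bcont_algebra"

lemma hilbert_module_bcont_module:
  "hilbert_module bcont_algebra (bcont_module :: ('a::metric_space \<Rightarrow> complex, _) hilbert_module)"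
  using cstar_algebra.hilbert_module_self_module cstar_algebra_bcont_algebra by blast

text \<open>Commutativity lets the factor \<open>cnj (b x)\<close> move from the first argument of
  the inner product to the second.\<close>

lemma is_adjoint_mult_op:
  assumes "b \<in> bcontfun"
  shows "is_adjoint bcont_module bcont_module (mult_op b) (mult_op (\<lambda>x. cnj (b x)))"
  using assms by (auto simp: is_adjoint_def mult_op_def mult_bcontfun cnj_bcontfun mult_ac)

lemma mult_op_adjointable:
  assumes "b \<in> bcontfun"
  shows "mult_op b \<in> adjointable bcont_module bcont_module"
proof -
  have "mult_op b \<in> carrier bcont_module \<rightarrow>\<^sub>E carrier bcont_module"
    using assms by (auto simp: mult_op_def mult_bcontfun)
  then show ?thesis
    using is_adjoint_mult_op[OF assms] unfolding adjointable_def by blast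
qed

text \<open>In a perfect space \<open>a\<close> is not isolated, so a continuous function's value
  there is the limit of its other values, and limits in a Hausdorff space are unique.\<close>

lemma continuous_on_eq_off_nonisolated:
  fixes f g :: "'a::perfect_space \<Rightarrow> 'b::t2_space"
  assumes f: "continuous_on UNIV f" and g: "continuous_on UNIV g"
    and eq: "\<And>x. x \<noteq> a \<Longrightarrow> f x = g x"
  shows "f = g"
proof -
  have "(f \<longlongrightarrow> f a) (at a)" "(g \<longlongrightarrow> g a) (at a)"
    using f g by (auto simp: continuous_on_def)
  moreover have "\<forall>\<^sub>F x in at a. f x = g x"
    using eq by (auto simp: eventually_at_filter)
  ultimately have "(g \<longlongrightarrow> f a) (at a)"
    using tendsto_cong by blast
  then have "f a = g a"
    using \<open>(g \<longlongrightarrow> g a) (at a)\<close> tendsto_unique trivial_limit_at by blast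
  then show ?thesis
    using eq by (metis ext)
qed

text \<open>Cancelling \<open>b x\<close> determines \<open>X f\<close> away from \<open>a\<close>;
  continuity of \<open>X f\<close> supplies the value at \<open>a\<close>.\<close>

lemma solutions_mult_op:
  fixes b :: "'a::perfect_space \<Rightarrow> complex"
  assumes b: "b \<in> bcontfun" and nz: "\<And>x. x \<noteq> a \<Longrightarrow> b x \<noteq> 0"
  shows "solutions bcont_module bcont_module (mult_op b) (mult_op b) = {mult_op (\<lambda>x. 1)}"
proof (intro equalityI subsetI)
  fix X :: "('a \<Rightarrow> complex) \<Rightarrow> 'a \<Rightarrow> complex"
  assume "X \<in> solutions bcont_module bcont_module (mult_op b) (mult_op b)"
  then have X: "X \<in> bcontfun \<rightarrow>\<^sub>E bcontfun"
    and eq: "compose bcontfun (mult_op b) X = mult_op b"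
    by (simp_all add: solutions_def adjointable_def)
  have "X f = f" if f: "f \<in> bcontfun" for f
  proof (rule continuous_on_eq_off_nonisolated)
    have Xf: "X f \<in> bcontfun"
      using X f by auto
    then show "continuous_on UNIV (X f)" "continuous_on UNIV f"
      using f by (simp_all add: bcontfun_def)
    fix x assume "x \<noteq> a"
    moreover have "b x * X f x = b x * f x"
      using fun_cong[OF fun_cong[OF eq, of f], of x] f Xf by (simp add: compose_def mult_op_def)
    ultimately show "X f x = f x"
      using nz by simp
  qed
  \<comment> \<open>Outside \<open>bcontfun\<close> both operators are \<open>undefined\<close>, so
    they agree as HOL functions.\<close>
  then have "X f = mult_op (\<lambda>x. 1) f" for f
    using PiE_arb[OF X, of f] by (cases "f \<in> bcontfun") (simp_all add: mult_op_def)
  then have "X = mult_op (\<lambda>x. 1)"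
    by (rule ext)
  then show "X \<in> {mult_op (\<lambda>x. 1)}"
    by simp
next
  fix X :: "('a \<Rightarrow> complex) \<Rightarrow> 'a \<Rightarrow> complex"
  assume "X \<in> {mult_op (\<lambda>x. 1)}"
  moreover have "compose bcontfun (mult_op b) (mult_op (\<lambda>x. 1)) = mult_op b"
    by (rule ext) (simp add: compose_def mult_op_def)
  ultimately show "X \<in> solutions bcont_module bcont_module (mult_op b) (mult_op b)"
    using mult_op_adjointable[OF const_bcontfun, of 1] by (simp add: solutions_def)
qed

text \<open>Evaluation at \<open>a\<close> is 1-Lipschitz for the supremum norm and vanishes on the
  range, hence also on its closure.\<close>

lemma norm_closure_range_mult_op:
  fixes b :: "'a::metric_space \<Rightarrow> complex"
  assumes b: "b \<in> bcontfun" and a: "b a = 0"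
    and h: "h \<in> norm_closure bcont_algebra bcont_module (mult_op b ` carrier bcont_module)"
  shows "h a = 0"
proof (rule ccontr)
  interpret Metric_space "bcontfun :: ('a \<Rightarrow> complex) set" "norm_dist bcont_algebra (cnorm bcont_algebra)"
    by (rule Metric_space_bcont_algebra)
  assume "h a \<noteq> 0"
  then have "cmod (h a) > 0"
    by simp
  moreover have "h \<in> mtopology closure_of (mult_op b ` bcontfun)"
    using h
    by (simp add: norm_closure_def
        cstar_algebra.norm_dist_self_module[OF cstar_algebra_bcont_algebra])
  \<comment> \<open>Every element of the range vanishes at \<open>a\<close> and so has distance at
    least \<open>cmod (h a)\<close> from \<open>h\<close>; the open ball of this radius cannot meet
    the range.\<close>
  ultimately obtain f where h: "h \<in> bcontfun" and f: "f \<in> bcontfun"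
    and near: "mult_op b f \<in> mball h (cmod (h a))"
    unfolding metric_closure_of by blast
  have bf: "(\<lambda>x. b x * f x) \<in> bcontfun"
    using mult_bcontfun b f .
  have "cmod (h a) = dist (h a) (b a * f a)"
    using a by simp
  also have "\<dots> \<le> dist (Bcontfun h) (Bcontfun (\<lambda>x. b x * f x))"
    using dist_bounded[of "Bcontfun h" a "Bcontfun (\<lambda>x. b x * f x)"] h bf
    by (simp add: Bcontfun_inverse)
  also have "\<dots> < cmod (h a)"
    using near h f bf by (simp add: mult_op_def norm_dist_bcont_algebra)
  finally show False
    by simp
qed

theorem theorem6p5:
  shows "\<exists>(\<AA> :: (real \<Rightarrow> complex) cstar_algebra)
           (E :: (real \<Rightarrow> complex, real \<Rightarrow> complex) hilbert_module)
           (H :: (real \<Rightarrow> complex, real \<Rightarrow> complex) hilbert_module)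
           (K :: (real \<Rightarrow> complex, real \<Rightarrow> complex) hilbert_module) A C.
         cstar_algebra \<AA> \<and>
         hilbert_module \<AA> E \<and> hilbert_module \<AA> H \<and> hilbert_module \<AA> K \<and>
         A \<in> adjointable H K \<and> C \<in> adjointable E K \<and>
         (\<exists>!X. X \<in> solutions E H A C) \<and>
         \<not> reduced_solution \<AA> E H K A C (THE X. X \<in> solutions E H A C)"
proof -
  \<comment> \<open>The cut-off at 1 keeps \<open>b\<close> bounded, its only zero is the
    non-isolated point 0, and real values make \<open>mult_op b\<close> its own adjoint.\<close>
  define b :: "real \<Rightarrow> complex" where "b t = of_real (min 1 \<bar>t\<bar>)" for t
  have "continuous_on UNIV b"
    unfolding b_def by (intro continuous_intros)
  then have b: "b \<in> bcontfun"
    by (rule bcontfun_normI[where b = 1]) (simp add: b_def)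
  have b_real: "(\<lambda>t. cnj (b t)) = b"
    by (simp add: b_def fun_eq_iff)
  have nz: "b t \<noteq> 0" if "t \<noteq> 0" for t
    using that by (simp add: b_def min_def)
  let ?H = "bcont_module :: (real \<Rightarrow> complex, real \<Rightarrow> complex) hilbert_module"
  interpret hilbert_module bcont_algebra ?H
    by (rule hilbert_module_bcont_module)
  have sol: "solutions ?H ?H (mult_op b) (mult_op b) = {mult_op (\<lambda>t. 1)}"
    using b nz by (rule solutions_mult_op)
  have adj: "adjoint_op ?H ?H (mult_op b) = mult_op b"
    using adjoint_op_eq[OF is_adjoint_mult_op[OF b]] by (simp add: b_real)
  have "\<not> reduced_solution bcont_algebra ?H ?H ?H (mult_op b) (mult_op b) (mult_op (\<lambda>t. 1))"
  proof
    assume "reduced_solution bcont_algebra ?H ?H ?H (mult_op b) (mult_op b) (mult_op (\<lambda>t. 1))"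
    \<comment> \<open>The test vector is the constant function 1, which the identity operator
      fixes.\<close>
    then have "mult_op (\<lambda>t. 1) (\<lambda>t. 1)
        \<in> norm_closure bcont_algebra ?H (mult_op b ` carrier ?H)"
      unfolding reduced_solution_def adj using const_bcontfun by fastforce
    then have "mult_op (\<lambda>t. 1) (\<lambda>t. 1) (0::real) = 0"
      by (rule norm_closure_range_mult_op[OF b, rotated]) (simp add: b_def)
    then show False
      by (simp add: mult_op_def const_bcontfun)
  qed
  \<comment> \<open>That the solution set is the singleton \<open>sol\<close> gives unique existence
    and also evaluates the \<open>THE\<close> term to the identity operator.\<close>
  then show ?thesis
    using cstar_algebra_bcont_algebra hilbert_module_bcont_module mult_op_adjointable[OF b]
    by (intro exI[of _ bcont_algebra] exI[of _ ?H] exI[of _ "mult_op b"]) (simp add: sol)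
qed

end
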